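(* Every Leibniz algebra of the family $M(\alpha)$, $\alpha\in\mathbb{C}$, is isomorphic to one of the following non-isomorphic algebras: $M(1)$ and $M(0)$.
   Context: A Leibniz algebra is a vector space $L$ with a bilinear product $[-,-]$ satisfying $[x,[y,z]]=[[x,y],z]-[[x,z],y]$ for all $x,y,z\in L$. For a complex parameter $\alpha$, $M(\alpha)$ denotes the eight-dimensional complex Leibniz algebra with basis $\{J,P_+,P_-,T,X_1,X_2,X_3,X_4\}$ and table of multiplication (omitted products are zero; $i$ is the imaginary unit) $$\begin{array}{ll} [J,P_+]=iP_+, & [P_+,J]=-iP_+,\\ [J,P_-]=-iP_-, & [P_-,J]=iP_-,\\ [P_+,P_-]=2iT, & [P_-,P_+]=-2iT,\\ [J,J]=\alpha X_2, & [X_1,J]=iX_1,\\ [X_4,J]=-iX_4, & [X_1,P_+]=X_2,\\ [X_3,P_-]=X_1, & [X_4,P_-]=-X_2,\\ [X_3,T]=\frac{i}{2}X_2. & \end{array}$$ *)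

theory Defs
  imports "HOL-Analysis.Analysis"
begin

text \<open>The identity below is the one for right Leibniz algebras: every right multiplication
  \<open>\<lambda>x. [x, z]\<close> is a derivation.\<close>

locale leibniz_algebra = vector_space scale
  for scale :: "'k::field \<Rightarrow> 'v::ab_group_add \<Rightarrow> 'v"
  and bracket :: "'v \<Rightarrow> 'v \<Rightarrow> 'v" +
  assumes linear_left: "\<And>y. Vector_Spaces.linear scale scale (\<lambda>x. bracket x y)"
    and linear_right: "\<And>x. Vector_Spaces.linear scale scale (\<lambda>y. bracket x y)"
    and leibniz: "\<And>x y z. bracket x (bracket y z)
          = bracket (bracket x y) z - bracket (bracket x z) y"

definition leibniz_isomorphic ::
  "('k::field \<Rightarrow> 'v::ab_group_add \<Rightarrow> 'v) \<Rightarrow> ('v \<Rightarrow> 'v \<Rightarrow> 'v) \<Rightarrow>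
   ('k \<Rightarrow> 'w::ab_group_add \<Rightarrow> 'w) \<Rightarrow> ('w \<Rightarrow> 'w \<Rightarrow> 'w) \<Rightarrow> bool"
  where "leibniz_isomorphic s1 br1 s2 br2 \<longleftrightarrow>
    (\<exists>f. Vector_Spaces.linear s1 s2 f \<and> bij f \<and> (\<forall>x y. f (br1 x y) = br2 (f x) (f y)))"

datatype M_basis = J | P_plus | P_minus | T | X1 | X2 | X3 | X4

lemma UNIV_M_basis: "UNIV = {J, P_plus, P_minus, T, X1, X2, X3, X4}"
  using M_basis.exhaust by auto

instance M_basis :: finite
  by standard (simp add: UNIV_M_basis)

abbreviation bvec :: "M_basis \<Rightarrow> complex ^ M_basis"
  where "bvec b \<equiv> axis b 1"

fun M_table :: "complex \<Rightarrow> M_basis \<Rightarrow> M_basis \<Rightarrow> complex ^ M_basis" where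
  "M_table \<alpha> J P_plus = \<i> *s bvec P_plus"
| "M_table \<alpha> P_plus J = (- \<i>) *s bvec P_plus"
| "M_table \<alpha> J P_minus = (- \<i>) *s bvec P_minus"
| "M_table \<alpha> P_minus J = \<i> *s bvec P_minus"
| "M_table \<alpha> P_plus P_minus = (2 * \<i>) *s bvec T"
| "M_table \<alpha> P_minus P_plus = (- 2 * \<i>) *s bvec T"
| "M_table \<alpha> J J = \<alpha> *s bvec X2"
| "M_table \<alpha> X1 J = \<i> *s bvec X1"
| "M_table \<alpha> X4 J = (- \<i>) *s bvec X4"
| "M_table \<alpha> X1 P_plus = bvec X2"
| "M_table \<alpha> X3 P_minus = bvec X1"
| "M_table \<alpha> X4 P_minus = - bvec X2"
| "M_table \<alpha> X3 T = (\<i> / 2) *s bvec X2"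
| "M_table \<alpha> _ _ = 0"

definition M :: "complex \<Rightarrow> complex ^ M_basis \<Rightarrow> complex ^ M_basis \<Rightarrow> complex ^ M_basis"
  where "M \<alpha> x y = (\<Sum>a\<in>UNIV. \<Sum>b\<in>UNIV. (x $ a * y $ b) *s M_table \<alpha> a b)"

lemma sum_M_basis:
  "(\<Sum>b\<in>UNIV. f b) = f J + f P_plus + f P_minus + f T + f X1 + f X2 + f X3 + (f X4 :: 'a::comm_monoid_add)"
  by (simp add: UNIV_M_basis add.assoc)

lemma bvec_nth: "bvec a $ b = (if a = b then 1 else 0)"
  by (simp add: axis_def)

lemma M_nth:
  "M \<alpha> x y $ J = 0"
  "M \<alpha> x y $ P_plus = \<i> * (x $ J * y $ P_plus - x $ P_plus * y $ J)"
  "M \<alpha> x y $ P_minus = \<i> * (x $ P_minus * y $ J - x $ J * y $ P_minus)"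
  "M \<alpha> x y $ T = 2 * \<i> * (x $ P_plus * y $ P_minus - x $ P_minus * y $ P_plus)"
  "M \<alpha> x y $ X1 = \<i> * x $ X1 * y $ J + x $ X3 * y $ P_minus"
  "M \<alpha> x y $ X2 = \<alpha> * x $ J * y $ J + x $ X1 * y $ P_plus - x $ X4 * y $ P_minus
      + \<i> / 2 * x $ X3 * y $ T"
  "M \<alpha> x y $ X3 = 0"
  "M \<alpha> x y $ X4 = - \<i> * x $ X4 * y $ J"
  by (simp_all add: M_def sum_M_basis bvec_nth right_diff_distrib)

lemma all_M_basis_iff:
  "(\<forall>b. Q b) \<longleftrightarrow> Q J \<and> Q P_plus \<and> Q P_minus \<and> Q T \<and> Q X1 \<and> Q X2 \<and> Q X3 \<and> Q X4"
proof -
  have "(\<forall>b. Q b) \<longleftrightarrow> (\<forall>b\<in>UNIV. Q b)" by simp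
  then show ?thesis unfolding UNIV_M_basis by simp
qed

lemma M_table_eq: "M \<alpha> (bvec a) (bvec b) = M_table \<alpha> a b"
proof -
  have "M \<alpha> (bvec a) (bvec b) = (\<Sum>c\<in>UNIV. \<Sum>d\<in>UNIV. if d = b then if c = a then M_table \<alpha> a b else 0 else 0)"
    unfolding M_def by (intro sum.cong refl) (auto simp: axis_def)
  then show ?thesis
    by simp
qed

lemma leibniz_algebra_M: "leibniz_algebra (*s) (M \<alpha>)"
proof unfold_locales
  show "M \<alpha> x (M \<alpha> y z) = M \<alpha> (M \<alpha> x y) z - M \<alpha> (M \<alpha> x z) y" for x y z
    unfolding vec_eq_iff all_M_basis_iff
  proof (intro conjI)
    have i2: "\<i> * (\<i> * c) = - c" for c
      by (simp add: mult.assoc [symmetric])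
    show "M \<alpha> x (M \<alpha> y z) $ X2 = (M \<alpha> (M \<alpha> x y) z - M \<alpha> (M \<alpha> x z) y) $ X2"
      by (simp add: M_nth algebra_simps i2)
  qed (simp_all add: M_nth algebra_simps)
qed (simp_all add: vec_eq_iff all_M_basis_iff M_nth algebra_simps)

end

theory Submission imports Defs begin

text \<open>If \<open>\<alpha> \<noteq> 0\<close>, multiplying \<open>X\<^sub>1, \<dots>, X\<^sub>4\<close> by \<open>1/\<alpha>\<close> carries \<open>M(\<alpha>)\<close> to \<open>M(1)\<close>, since every
  product other than \<open>[J, J]\<close> contains as many of the \<open>X\<^sub>k\<close> as its value does. Conversely, if
  \<open>M(\<alpha>) \<cong> M(0)\<close>, the preimages \<open>y, p, q, t\<close> of \<open>J, P\<^sub>+, P\<^sub>-, T\<close> satisfy \<open>[y, y] = 0\<close>,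
  \<open>[y, p] = ip\<close>, \<open>[y, q] = -iq\<close> and \<open>[p, q] = 2it\<close>. As \<open>p \<noteq> 0\<close>, the \<open>J\<close>-coordinate of \<open>y\<close> is
  nonzero. As \<open>[y, t] = 0\<close> but \<open>[u, t] \<noteq> 0\<close> for some \<open>u\<close>, its \<open>X\<^sub>3\<close>-coordinate vanishes. Then
  \<open>[y, y] = 0\<close> forces \<open>\<alpha> = 0\<close>.\<close>

lemma M_isomorphic_M_1:
  assumes "\<alpha> \<noteq> 0"
  shows "leibniz_isomorphic (*s) (M \<alpha>) (*s) (M 1)"
proof -
  define c where "c b = (if b \<in> {X1, X2, X3, X4} then 1 / \<alpha> else 1)" for b
  define f :: "complex ^ M_basis \<Rightarrow> complex ^ M_basis" where "f x = (\<chi> b. c b * x $ b)" for x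
  have f_nth: "f x $ b = c b * x $ b" for x b
    by (simp add: f_def)
  have c: "c b \<noteq> 0" for b
    using assms by (simp add: c_def)
  have "Vector_Spaces.linear (*s) (*s) f"
    by unfold_locales (simp_all add: vec_eq_iff f_nth algebra_simps)
  moreover have "bij f"
  proof (rule bijI')
    show "f x = f y \<longleftrightarrow> x = y" for x y
      using c by (auto simp: vec_eq_iff f_nth)
    show "\<exists>x. y = f x" for y
      by (rule exI [of _ "\<chi> b. y $ b / c b"]) (simp add: vec_eq_iff f_nth c)
  qed
  moreover have "f (M \<alpha> x y) = M 1 (f x) (f y)" for x y
    using assms by (simp add: vec_eq_iff all_M_basis_iff f_nth M_nth c_def field_simps)
  ultimately show ?thesis
    unfolding leibniz_isomorphic_def by blast
qed

lemma M_0_isomorphism_imp_zero: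
  assumes "leibniz_isomorphic (*s) (M \<alpha>) (*s) (M 0)"
  shows "\<alpha> = 0"
proof -
  obtain f where lin: "Vector_Spaces.linear (*s) (*s) f" and bij: "bij f"
    and hom: "\<And>x y. f (M \<alpha> x y) = M 0 (f x) (f y)"
    using assms unfolding leibniz_isomorphic_def by blast
  interpret f: Vector_Spaces.linear "(*s)" "(*s)" f by (fact lin)
  have f_eq_iff: "f x = f y \<longleftrightarrow> x = y" for x y
    using bij by (simp add: bij_def inj_eq)
  have surj: "\<exists>x. f x = b" for b
    using bij by (metis bij_pointE)
  obtain y p q t u where gen: "f y = bvec J" "f p = bvec P_plus" "f q = bvec P_minus"
    "f t = bvec T" "f u = bvec X3"
    using surj by metis
  \<comment> \<open>Injectivity of \<open>f\<close> pulls relations in \<open>M 0\<close> back to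
    \<open>M \<alpha>\<close>.\<close>
  have bracket_eq: "M \<alpha> a b = c *s d" if "M 0 (f a) (f b) = c *s f d" for a b c d
    using that by (metis f_eq_iff hom f.scale)
  have yy: "M \<alpha> y y = 0 *s y"
    by (rule bracket_eq) (simp add: gen M_table_eq)
  have yp: "M \<alpha> y p = \<i> *s p"
    by (rule bracket_eq) (simp add: gen M_table_eq)
  have yq: "M \<alpha> y q = (- \<i>) *s q"
    by (rule bracket_eq) (simp add: gen M_table_eq)
  have pq: "M \<alpha> p q = (2 * \<i>) *s t"
    by (rule bracket_eq) (simp add: gen M_table_eq)
  have yt: "M \<alpha> y t = 0 *s t"
    by (rule bracket_eq) (simp add: gen M_table_eq)
  have ut: "M \<alpha> u t \<noteq> 0"
  proof
    assume "M \<alpha> u t = 0"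
    then have "M 0 (bvec X3) (bvec T) = 0"
      by (metis f.zero hom gen(4,5))
    then show False
      by (simp add: M_table_eq vec_eq_iff all_M_basis_iff bvec_nth)
  qed
  have "p \<noteq> 0"
    using gen(2) by (auto simp: eq_commute [of 0])
  have pJ: "p $ J = 0" and qJ: "q $ J = 0"
    using arg_cong [OF yp, of "\<lambda>x. x $ J"] arg_cong [OF yq, of "\<lambda>x. x $ J"]
    by (simp_all add: M_nth)
  have yJ: "y $ J \<noteq> 0"
  proof
    assume "y $ J = 0"
    \<comment> \<open>The coordinates of \<open>p\<close> vanish in turn: \<open>P_plus\<close> and
      \<open>P_minus\<close>, then \<open>T\<close> and \<open>X1\<close>, then
      \<open>X2\<close>.\<close>
    with yp pJ have "p = 0"
      by (auto simp: vec_eq_iff all_M_basis_iff M_nth)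
    with \<open>p \<noteq> 0\<close> show False ..
  qed
  have t: "t $ J = 0" "t $ P_plus = 0" "t $ P_minus = 0"
    using pq pJ qJ by (simp_all add: vec_eq_iff all_M_basis_iff M_nth)
  \<comment> \<open>For such \<open>t\<close>, the only term left in \<open>M \<alpha> x t\<close>
    is \<open>\<i> / 2 * x $ X3 * t $ T\<close>, at \<open>X2\<close>.\<close>
  then have "t $ T \<noteq> 0"
    using ut by (auto simp: vec_eq_iff all_M_basis_iff M_nth)
  then have "y $ X3 = 0"
    using yt t by (simp add: vec_eq_iff all_M_basis_iff M_nth)
  \<comment> \<open>Coordinates \<open>X1\<close> and \<open>X4\<close> of \<open>yy\<close> give
    \<open>y $ X1 = 0\<close> and \<open>y $ X4 = 0\<close>; then \<open>X2\<close> reads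
    \<open>\<alpha> * y $ J * y $ J = 0\<close>.\<close>
  then show ?thesis
    using yy yJ by (auto simp: vec_eq_iff all_M_basis_iff M_nth)
qed

theorem theorem4:
  "(\<forall>\<alpha>. leibniz_isomorphic (*s) (M \<alpha>) (*s) (M 1) \<or> leibniz_isomorphic (*s) (M \<alpha>) (*s) (M 0)) \<and>
   \<not> leibniz_isomorphic (*s) (M 1) (*s) (M 0)"
proof (intro conjI allI)
  have "leibniz_isomorphic (*s) (M 0) (*s) (M 0)"
    unfolding leibniz_isomorphic_def by (rule exI [of _ id]) (simp add: vec.linear_id)
  then show "leibniz_isomorphic (*s) (M \<alpha>) (*s) (M 1) \<or> leibniz_isomorphic (*s) (M \<alpha>) (*s) (M 0)"
    for \<alpha>
    by (cases "\<alpha> = 0") (simp_all add: M_isomorphic_M_1)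
  show "\<not> leibniz_isomorphic (*s) (M 1) (*s) (M 0)"
    using M_0_isomorphism_imp_zero [of 1] by auto
qed

end
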